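(* Let $\mathbb{F}$ be a field and let $f:\{0,1\}^n\to\mathbb{F}$ be non-zero, with multilinear representation $f(x)=\sum_{S\subseteq[n]}c_S x^S$, $c_S\in\mathbb{F}$. Suppose that $S\subseteq[n]$ satisfies $c_S\neq 0$ and $|S|=\deg_{\mathbb{F}}(f)$. Then $\mathrm{supp}(f)$ shatters $S^c=[n]\setminus S$.
   Context: $[n]=\{1,\dots,n\}$. For a field $\mathbb{F}$, every function $f:\{0,1\}^n\to\mathbb{F}$ has a unique multilinear representation $f(x)=\sum_{S\subseteq[n]}c_S x^S$ with $c_S\in\mathbb{F}$ and $x^S=\prod_{i\in S}x_i$ (where $0,1$ are read in $\mathbb{F}$). For non-zero $f$, $\deg_{\mathbb{F}}(f):=\max\{|S|:c_S\neq0\}$. The support is $\mathrm{supp}(f):=\{x\in\{0,1\}^n:f(x)\neq0\}$; each $x\in\{0,1\}^n$ is identified with the set $\{i:x_i=1\}\subseteq[n]$, so $\mathrm{supp}(f)$ is viewed as a family of subsets of $[n]$. A family $\mathcal{A}\subseteq 2^{[n]}$ shatters $T\subseteq[n]$ if for every $B\subseteq T$ there is $A\in\mathcal{A}$ with $A\cap T=B$. *)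

theory Defs
  imports Main "HOL-Library.FuncSet"
begin

text \<open>The cube: its points are functions on \<open>{1..n}\<close> (\<open>undefined\<close> elsewhere). A function
  \<open>f\<close> on the cube is an arbitrary HOL function of which only the values on \<open>cube n\<close> are used.\<close>

definition cube :: "nat \<Rightarrow> (nat \<Rightarrow> nat) set" where
  "cube n = {1..n} \<rightarrow>\<^sub>E {0, 1}"

text \<open>The embedding \<open>of_nat\<close> reads the coordinates 0 and 1 in the field.\<close>

definition mono_val :: "nat set \<Rightarrow> (nat \<Rightarrow> nat) \<Rightarrow> 'a::field" where
  "mono_val S x = (\<Prod>i\<in>S. of_nat (x i))"

definition multilinear_rep :: "nat \<Rightarrow> ((nat \<Rightarrow> nat) \<Rightarrow> 'a::field) \<Rightarrow> (nat set \<Rightarrow> 'a) \<Rightarrow> bool" where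
  "multilinear_rep n f c \<longleftrightarrow> (\<forall>x\<in>cube n. f x = (\<Sum>S\<in>Pow {1..n}. c S * mono_val S x))"

definition point_of :: "nat \<Rightarrow> nat set \<Rightarrow> nat \<Rightarrow> nat" where
  "point_of n T = (\<lambda>i\<in>{1..n}. if i \<in> T then 1 else 0)"

lemma cube_eq: "cube n = point_of n ` Pow {1..n}"
proof
  show "cube n \<subseteq> point_of n ` Pow {1..n}"
  proof
    fix x assume x: "x \<in> cube n"
    have "x = point_of n {i \<in> {1..n}. x i = 1}"
    proof
      fix i
      show "x i = point_of n {i \<in> {1..n}. x i = 1} i"
        using x PiE_mem[of x "{1..n}" "\<lambda>_. {0, 1}" i] PiE_arb[of x "{1..n}" "\<lambda>_. {0, 1}" i]
        by (cases "i \<in> {1..n}") (auto simp: cube_def point_of_def)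
    qed
    then show "x \<in> point_of n ` Pow {1..n}" by blast
  qed
qed (auto simp: cube_def point_of_def split: if_splits)

lemma mono_val_point_of:
  assumes "S \<subseteq> {1..n}"
  shows "(mono_val S (point_of n T) :: 'a::field) = (if S \<subseteq> T then 1 else 0)"
proof -
  have "finite S" using assms finite_subset by blast
  moreover have "(mono_val S (point_of n T) :: 'a) = (\<Prod>i\<in>S. if i \<in> T then 1 else 0)"
    unfolding mono_val_def by (rule prod.cong) (use assms in \<open>auto simp: point_of_def\<close>)
  ultimately show ?thesis by (auto intro!: prod.neutral)
qed

lemma multilinear_rep_iff:
  "multilinear_rep n f c \<longleftrightarrow> (\<forall>T\<in>Pow {1..n}. f (point_of n T) = sum c (Pow T))"
proof -
  have "(\<Sum>S\<in>Pow {1..n}. c S * mono_val S (point_of n T)) = sum c (Pow T)"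
    if "T \<in> Pow {1..n}" for T
  proof -
    have "(\<Sum>S\<in>Pow {1..n}. c S * mono_val S (point_of n T))
        = (\<Sum>S\<in>Pow {1..n}. if S \<in> Pow T then c S else 0)"
      by (rule sum.cong) (auto simp: mono_val_point_of)
    also have "\<dots> = sum c (Pow {1..n} \<inter> Pow T)"
      by (simp add: sum.inter_restrict)
    also have "Pow {1..n} \<inter> Pow T = Pow T" using that by auto
    finally show ?thesis .
  qed
  then show ?thesis unfolding multilinear_rep_def cube_eq by auto
qed

lemma multilinear_rep_unique:
  assumes "multilinear_rep n f c" "multilinear_rep n f d" "S \<subseteq> {1..n}"
  shows "c S = d S"
proof -
  have fin: "finite S" using assms(3) finite_subset by blast
  have "c S = (\<Sum>T\<in>Pow S. (-1) ^ (card S - card T) * sum c (Pow T))"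
    by (rule inclusion_exclusion_mobius) (use fin in auto)
  also have "\<dots> = (\<Sum>T\<in>Pow S. (-1) ^ (card S - card T) * sum d (Pow T))"
  proof (rule sum.cong)
    fix T assume "T \<in> Pow S"
    then have "T \<in> Pow {1..n}" using assms(3) by auto
    then have "sum c (Pow T) = sum d (Pow T)"
      using assms(1,2) unfolding multilinear_rep_iff by metis
    then show "(-1) ^ (card S - card T) * sum c (Pow T) = (-1) ^ (card S - card T) * sum d (Pow T)"
      by simp
  qed simp
  also have "\<dots> = d S"
    by (rule inclusion_exclusion_mobius[symmetric]) (use fin in auto)
  finally show ?thesis .
qed

lemma ex1_multilinear_rep:
  fixes f :: "(nat \<Rightarrow> nat) \<Rightarrow> 'a::field"
  shows "\<exists>!c. c \<in> extensional (Pow {1..n}) \<and> multilinear_rep n f c"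
proof (rule ex_ex1I)
  define h where "h S = (\<Sum>T\<in>Pow S. (-1) ^ card T * f (point_of n T))" for S
  define c where "c = (\<lambda>S\<in>Pow {1..n}. (-1) ^ card S * h S)"
  have "f (point_of n T) = sum c (Pow T)" if "T \<in> Pow {1..n}" for T
  proof -
    have "finite T" using that finite_subset by blast
    then have "f (point_of n T) = (\<Sum>U\<in>Pow T. (-1) ^ card U * h U)"
      by (rule inclusion_exclusion_symmetric[rotated]) (simp add: h_def)
    also have "\<dots> = sum c (Pow T)"
      by (rule sum.cong) (use that in \<open>auto simp: c_def\<close>)
    finally show ?thesis .
  qed
  then show "\<exists>c. c \<in> extensional (Pow {1..n}) \<and> multilinear_rep n f c"
    unfolding multilinear_rep_iff by (intro exI[of _ c]) (auto simp: c_def)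
next
  fix c d :: "nat set \<Rightarrow> 'a"
  assume c: "c \<in> extensional (Pow {1..n}) \<and> multilinear_rep n f c"
    and d: "d \<in> extensional (Pow {1..n}) \<and> multilinear_rep n f d"
  show "c = d"
    by (rule extensionalityI[of _ "Pow {1..n}"])
      (use c d multilinear_rep_unique[of n f c d] in auto)
qed

text \<open>The coefficient family is unique on subsets of \<open>{1..n}\<close>, see \<open>multilinear_rep_unique\<close>;
  \<open>extensional\<close> fixes its irrelevant values on all other sets.\<close>

definition ml_coeff :: "nat \<Rightarrow> ((nat \<Rightarrow> nat) \<Rightarrow> 'a::field) \<Rightarrow> nat set \<Rightarrow> 'a" where
  "ml_coeff n f = (THE c. c \<in> extensional (Pow {1..n}) \<and> multilinear_rep n f c)"

lemma ml_coeff_eq: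
  assumes "multilinear_rep n f c" "S \<subseteq> {1..n}"
  shows "ml_coeff n f S = c S"
  using theI'[OF ex1_multilinear_rep[of n f]] multilinear_rep_unique assms
  unfolding ml_coeff_def by blast

text \<open>Only meaningful if \<open>f\<close> is non-zero on the cube; otherwise this is \<open>Max {}\<close>.\<close>

definition ml_degree :: "nat \<Rightarrow> ((nat \<Rightarrow> nat) \<Rightarrow> 'a::field) \<Rightarrow> nat" where
  "ml_degree n f = Max {card S | S. S \<subseteq> {1..n} \<and> ml_coeff n f S \<noteq> 0}"

definition supp :: "nat \<Rightarrow> ((nat \<Rightarrow> nat) \<Rightarrow> 'a::field) \<Rightarrow> (nat \<Rightarrow> nat) set" where
  "supp n f = {x \<in> cube n. f x \<noteq> 0}"

definition set_of_point :: "nat \<Rightarrow> (nat \<Rightarrow> nat) \<Rightarrow> nat set" where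
  "set_of_point n x = {i \<in> {1..n}. x i = 1}"

definition shatters :: "nat set set \<Rightarrow> nat set \<Rightarrow> bool" where
  "shatters \<A> T \<longleftrightarrow> (\<forall>B. B \<subseteq> T \<longrightarrow> (\<exists>A\<in>\<A>. A \<inter> T = B))"

end

theory Submission
  imports Defs
begin

text \<open>
  Let \<open>B\<close> be disjoint from \<open>S\<close> and fix the coordinates outside \<open>S\<close> to the indicator of \<open>B\<close>.
  What remains of \<open>f\<close> is a function on the subcube of subsets of \<open>S\<close>, again multilinear, and
  the coefficient of \<open>x\<^sup>V\<close> in it is \<open>\<Sum>W\<subseteq>B. c (V \<union> W)\<close> (\<open>sum_Pow_Un_disjoint\<close>).
  For \<open>V = S\<close> every term with \<open>W \<noteq> {}\<close> belongs to a set larger than the degree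
  (\<open>rep_coeff_zero_above_degree\<close>), so this coefficient is \<open>c S \<noteq> 0\<close>. By Moebius inversion a
  function with a non-zero coefficient does not vanish on its whole cube. Hence \<open>f\<close> is non-zero
  at \<open>U \<union> B\<close> for some \<open>U \<subseteq> S\<close>, and this point of the support has trace \<open>B\<close> outside \<open>S\<close>.
\<close>

lemma set_of_point_point_of:
  assumes "T \<subseteq> {1..n}"
  shows "set_of_point n (point_of n T) = T"
  using assms by (auto simp: set_of_point_def point_of_def split: if_splits)

lemma sum_Pow_Un_disjoint:
  assumes "A \<inter> B = {}"
  shows "sum c (Pow (A \<union> B)) = (\<Sum>V\<in>Pow A. \<Sum>W\<in>Pow B. c (V \<union> W))"
proof -
  have "(\<Sum>V\<in>Pow A. \<Sum>W\<in>Pow B. c (V \<union> W)) = (\<Sum>(V, W)\<in>Pow A \<times> Pow B. c (V \<union> W))"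
    by (rule sum.cartesian_product)
  also have "\<dots> = sum c (Pow (A \<union> B))"
    by (rule sum.reindex_bij_witness[of _ "\<lambda>T. (T \<inter> A, T \<inter> B)" "\<lambda>(V, W). V \<union> W"])
      (use assms in auto)
  finally show ?thesis ..
qed

text \<open>The degree is defined through the canonical coefficients; by uniqueness it bounds
  any representing family.\<close>

lemma rep_coeff_zero_above_degree:
  assumes "multilinear_rep n f c" "T \<subseteq> {1..n}" "ml_degree n f < card T"
  shows "c T = 0"
proof (rule ccontr)
  let ?D = "{card S | S. S \<subseteq> {1..n} \<and> ml_coeff n f S \<noteq> 0}"
  assume "c T \<noteq> 0"
  then have "card T \<in> ?D"
    using assms(2) ml_coeff_eq[OF assms(1,2)] by auto
  moreover have "finite ?D"
    by (rule finite_subset[of _ "card ` Pow {1..n}"]) auto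
  ultimately have "card T \<le> ml_degree n f"
    unfolding ml_degree_def by (rule Max_ge[rotated])
  then show False using assms(3) by simp
qed

theorem theorem1p2:
  fixes n :: nat
    and f :: "(nat \<Rightarrow> nat) \<Rightarrow> 'a::field"
    and c :: "nat set \<Rightarrow> 'a"
    and S :: "nat set"
  assumes nonzero: "\<exists>x\<in>cube n. f x \<noteq> 0"
    and rep: "multilinear_rep n f c"
    and S: "S \<subseteq> {1..n}"
    and cS: "c S \<noteq> 0"
    and deg: "card S = ml_degree n f"
  shows "shatters (set_of_point n ` supp n f) ({1..n} - S)"
  unfolding shatters_def
proof (intro allI impI)
  fix B assume B: "B \<subseteq> {1..n} - S"
  have fin: "finite S" "finite B"
    using S B by (auto intro: finite_subset)
  define h where "h V = (\<Sum>W\<in>Pow B. c (V \<union> W))" for V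
  have f_eq: "f (point_of n (U \<union> B)) = sum h (Pow U)" if "U \<subseteq> S" for U
  proof -
    have "f (point_of n (U \<union> B)) = sum c (Pow (U \<union> B))"
      using rep that S B unfolding multilinear_rep_iff by blast
    also have "U \<inter> B = {}" using that B by blast
    then have "sum c (Pow (U \<union> B)) = sum h (Pow U)"
      unfolding h_def by (rule sum_Pow_Un_disjoint)
    finally show ?thesis .
  qed
  have "c (S \<union> W) = 0" if "W \<in> Pow B - {{}}" for W
  proof (rule rep_coeff_zero_above_degree[OF rep])
    show "S \<union> W \<subseteq> {1..n}" using that S B by blast
    have "finite (S \<union> W)" using that fin by (auto intro: finite_subset)
    moreover have "S \<subset> S \<union> W" using that B by blast
    ultimately show "ml_degree n f < card (S \<union> W)"
      unfolding deg[symmetric] by (rule psubset_card_mono)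
  qed
  then have "h S = (\<Sum>W\<in>{{}}. c (S \<union> W))"
    unfolding h_def using fin by (intro sum.mono_neutral_right) auto
  then have hS: "h S \<noteq> 0" using cS by simp
  have "h S = (\<Sum>U\<in>Pow S. (-1) ^ (card S - card U) * sum h (Pow U))"
    by (rule inclusion_exclusion_mobius) (use fin in auto)
  with hS obtain U where U: "U \<subseteq> S" "sum h (Pow U) \<noteq> 0"
    by (metis (no_types, lifting) Pow_iff mult_zero_right sum.neutral)
  let ?x = "point_of n (U \<union> B)"
  have UB: "U \<union> B \<subseteq> {1..n}" using U S B by blast
  then have "?x \<in> supp n f"
    using U f_eq by (auto simp: supp_def cube_eq)
  moreover have "set_of_point n ?x \<inter> ({1..n} - S) = B"
    using set_of_point_point_of[OF UB] U B by auto
  ultimately show "\<exists>A\<in>set_of_point n ` supp n f. A \<inter> ({1..n} - S) = B"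
    by blast
qed

end
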